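(* Let $k\ge 4$ be an integer. Then for every sufficiently large integer $d$ there exists a tree $T$ with diameter $d$ and order $n=2d+1$ such that $\mu_{tsp,k}(C_n)<\mu_{tsp,k}(T)$.
   Context: $C_n$ is the cycle on $n$ vertices. For a set $S$ of $k$ vertices of a connected graph $G$ of order $n$, $\mathrm{tsp}_k(S)$ is the length (number of edge traversals, with multiplicity) of a shortest closed walk in $G$ visiting all vertices of $S$, and $\mu_{tsp,k}(G)=\binom{n}{k}^{-1}\sum_{S\subseteq V,\,|S|=k}\mathrm{tsp}_k(S)$. *)

theory Defs
  imports Complex_Main
begin

definition simple_graph :: "'a set \<Rightarrow> ('a \<Rightarrow> 'a \<Rightarrow> bool) \<Rightarrow> bool" where
  "simple_graph V E \<longleftrightarrow> finite V \<and> (\<forall>u v. E u v \<longrightarrow> u \<in> V \<and> v \<in> V \<and> u \<noteq> v \<and> E v u)"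

definition is_walk :: "'a set \<Rightarrow> ('a \<Rightarrow> 'a \<Rightarrow> bool) \<Rightarrow> 'a list \<Rightarrow> bool" where
  "is_walk V E xs \<longleftrightarrow> xs \<noteq> [] \<and> set xs \<subseteq> V \<and> (\<forall>i. Suc i < length xs \<longrightarrow> E (xs ! i) (xs ! Suc i))"

definition walk_len :: "'a list \<Rightarrow> nat" where
  "walk_len xs = length xs - 1"

definition connected_graph :: "'a set \<Rightarrow> ('a \<Rightarrow> 'a \<Rightarrow> bool) \<Rightarrow> bool" where
  "connected_graph V E \<longleftrightarrow> V \<noteq> {} \<and>
     (\<forall>u\<in>V. \<forall>v\<in>V. \<exists>xs. is_walk V E xs \<and> hd xs = u \<and> last xs = v)"

definition has_cycle :: "'a set \<Rightarrow> ('a \<Rightarrow> 'a \<Rightarrow> bool) \<Rightarrow> bool" where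
  "has_cycle V E \<longleftrightarrow> (\<exists>xs. length xs \<ge> 3 \<and> distinct xs \<and> is_walk V E xs \<and> E (last xs) (hd xs))"

definition is_tree :: "'a set \<Rightarrow> ('a \<Rightarrow> 'a \<Rightarrow> bool) \<Rightarrow> bool" where
  "is_tree V E \<longleftrightarrow> simple_graph V E \<and> connected_graph V E \<and> \<not> has_cycle V E"

definition graph_dist :: "'a set \<Rightarrow> ('a \<Rightarrow> 'a \<Rightarrow> bool) \<Rightarrow> 'a \<Rightarrow> 'a \<Rightarrow> nat" where
  "graph_dist V E u v = (LEAST m. \<exists>xs. is_walk V E xs \<and> hd xs = u \<and> last xs = v \<and> walk_len xs = m)"

definition diameter :: "'a set \<Rightarrow> ('a \<Rightarrow> 'a \<Rightarrow> bool) \<Rightarrow> nat" where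
  "diameter V E = Max {graph_dist V E u v | u v. u \<in> V \<and> v \<in> V}"

definition tsp :: "'a set \<Rightarrow> ('a \<Rightarrow> 'a \<Rightarrow> bool) \<Rightarrow> 'a set \<Rightarrow> nat" where
  "tsp V E S = (LEAST m. \<exists>xs. is_walk V E xs \<and> hd xs = last xs \<and> S \<subseteq> set xs \<and> walk_len xs = m)"

definition mu_tsp :: "nat \<Rightarrow> 'a set \<Rightarrow> ('a \<Rightarrow> 'a \<Rightarrow> bool) \<Rightarrow> real" where
  "mu_tsp k V E = (\<Sum>S\<in>{S. S \<subseteq> V \<and> card S = k}. real (tsp V E S)) / real (card V choose k)"

definition cycle_adj :: "nat \<Rightarrow> nat \<Rightarrow> nat \<Rightarrow> bool" where
  "cycle_adj n i j \<longleftrightarrow> i < n \<and> j < n \<and> i \<noteq> j \<and> (j = (i + 1) mod n \<or> i = (j + 1) mod n)"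

end

theory Submission
  imports Defs "HOL-Real_Asymp.Real_Asymp"
begin

text \<open>A closed walk crosses the edge above a vertex u of a tree an even number of times, so
  tsp(S) is at least twice the number of vertices u whose subtree splits S. In a tree with n vertices
  a subtree with a vertices fails to split a random k-set with probability at most
  (a/n)^k + (1 - a/n)^k. For three legs of length d/2, each with about d/6 extra leaves at its end,
  a/n runs uniformly from 1/12 to 1/3, and the average tour is at least n times a
  constant tending to 3/2 - 6/(k+1) ((11/12)^(k+1) - (2/3)^(k+1) + (1/3)^(k+1) - (1/12)^(k+1)).

  In the cycle a tour either goes around or turns back at both ends of a gap longer than n/2, which gives
  tsp(S) \<le> n + 1 - 2 f(S), where f(S) is the number of arcs of d vertices that avoid S; the average
  is asymptotically at most n (1 - 2^(1-k)). For k = 4 and k = 5 the first constant is larger (for k = 4 by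
  only 0.0014), and for k \<ge> 6 the bound for the tree with exponent 6 in place of k already exceeds n.\<close>

subsection \<open>Tours and cuts\<close>

lemma is_walk_iff:
  "is_walk V E xs \<longleftrightarrow> xs \<noteq> [] \<and> set xs \<subseteq> V \<and> successively E xs"
  by (auto simp: is_walk_def successively_conv_nth)

lemma is_walk_append:
  assumes "is_walk V E xs" "is_walk V E ys" "last xs = hd ys"
  shows "is_walk V E (xs @ tl ys)" "hd (xs @ tl ys) = hd xs" "last (xs @ tl ys) = last ys"
    "walk_len (xs @ tl ys) = walk_len xs + walk_len ys" "set (xs @ tl ys) = set xs \<union> set ys"
proof -
  obtain y zs where ys: "ys = y # zs"
    using assms(2) by (cases ys) (auto simp: is_walk_iff)
  have ne: "xs \<noteq> []" and y: "last xs = y"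
    using assms ys by (auto simp: is_walk_iff)
  show "is_walk V E (xs @ tl ys)" "hd (xs @ tl ys) = hd xs" "last (xs @ tl ys) = last ys"
    using assms ys ne y
    by (auto simp: is_walk_iff successively_append_iff successively_Cons)
  show "walk_len (xs @ tl ys) = walk_len xs + walk_len ys"
    using ne ys by (cases xs) (auto simp: walk_len_def)
  show "set (xs @ tl ys) = set xs \<union> set ys"
    using ne ys y last_in_set[of xs] by auto
qed

lemma is_walk_rev:
  assumes "is_walk V E xs" "\<And>u v. E u v \<Longrightarrow> E v u"
  shows "is_walk V E (rev xs)" "walk_len (rev xs) = walk_len xs"
proof -
  have "successively (\<lambda>x y. E y x) xs"
    using assms successively_mono[of E xs "\<lambda>x y. E y x"] by (meson is_walk_iff)
  then show "is_walk V E (rev xs)" "walk_len (rev xs) = walk_len xs"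
    using assms(1) by (auto simp: is_walk_iff walk_len_def)
qed

lemma walk_change_le:
  fixes \<phi> :: "'a \<Rightarrow> int"
  assumes "is_walk V E xs" "\<And>u v. E u v \<Longrightarrow> \<bar>\<phi> u - \<phi> v\<bar> \<le> 1"
  shows "\<bar>\<phi> (hd xs) - \<phi> (last xs)\<bar> \<le> int (walk_len xs)"
proof -
  have "xs \<noteq> [] \<Longrightarrow> successively E xs \<Longrightarrow> \<bar>\<phi> (hd xs) - \<phi> (last xs)\<bar> \<le> int (length xs) - 1"
  proof (induction xs rule: induct_list012)
    case (3 x y zs)
    then show ?case using assms(2)[of x y] by auto
  qed auto
  then show ?thesis
    using assms(1) by (cases xs) (auto simp: is_walk_iff walk_len_def)
qed

lemma graph_dist_le:
  "is_walk V E xs \<Longrightarrow> graph_dist V E (hd xs) (last xs) \<le> walk_len xs"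
  unfolding graph_dist_def by (rule Least_le) auto

text \<open>A potential that changes by at most 1 along each edge certifies a lower bound on
  distances. Connectivity ensures that the \<open>LEAST\<close> in \<open>graph_dist\<close> is
  attained by an actual walk, to which the potential is applied.\<close>

lemma graph_dist_ge:
  fixes \<phi> :: "'a \<Rightarrow> int"
  assumes "connected_graph V E" "u \<in> V" "v \<in> V" "\<And>u v. E u v \<Longrightarrow> \<bar>\<phi> u - \<phi> v\<bar> \<le> 1"
  shows "\<bar>\<phi> u - \<phi> v\<bar> \<le> int (graph_dist V E u v)"
proof -
  have "\<exists>m xs. is_walk V E xs \<and> hd xs = u \<and> last xs = v \<and> walk_len xs = m"
    using assms unfolding connected_graph_def by blast
  from LeastI_ex[OF this] obtain xs where xs: "is_walk V E xs" "hd xs = u" "last xs = v"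
    "walk_len xs = graph_dist V E u v"
    unfolding graph_dist_def by auto
  show ?thesis using walk_change_le[OF xs(1), of \<phi>, OF assms(4)] xs(2-4) by simp
qed

text \<open>Fix a root and concatenate one excursion to each vertex of \<open>S\<close> and back.
  This makes the \<open>LEAST\<close> in \<open>tsp\<close> range over a nonempty set, so that a
  shortest tour exists.\<close>

lemma closed_walk_covering:
  assumes "connected_graph V E" "finite S" "S \<subseteq> V"
  shows "\<exists>xs. is_walk V E xs \<and> hd xs = last xs \<and> S \<subseteq> set xs"
proof -
  obtain r where r: "r \<in> V" using assms(1) by (auto simp: connected_graph_def)
  have "\<exists>xs. is_walk V E xs \<and> hd xs = r \<and> last xs = r \<and> S \<subseteq> set xs"
    using assms(2,3)
  proof (induction S rule: finite_induct)
    case empty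
    show ?case using r by (intro exI[of _ "[r]"]) (auto simp: is_walk_iff)
  next
    case (insert v S)
    then obtain xs where xs: "is_walk V E xs" "hd xs = r" "last xs = r" "S \<subseteq> set xs" by auto
    obtain ys where ys: "is_walk V E ys" "hd ys = r" "last ys = v"
      using assms(1) r insert.prems unfolding connected_graph_def by blast
    obtain zs where zs: "is_walk V E zs" "hd zs = v" "last zs = r"
      using assms(1) r insert.prems unfolding connected_graph_def by blast
    have "v \<in> set ys" using ys last_in_set[of ys] by (auto simp: is_walk_iff)
    define ws where "ws = ys @ tl zs"
    have ws: "is_walk V E ws" "hd ws = r" "last ws = r" "v \<in> set ws"
      using is_walk_append[OF ys(1) zs(1)] ys zs \<open>v \<in> set ys\<close> unfolding ws_def by auto
    have "is_walk V E (xs @ tl ws)" "hd (xs @ tl ws) = r" "last (xs @ tl ws) = r"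
      "insert v S \<subseteq> set (xs @ tl ws)"
      using is_walk_append[OF xs(1) ws(1)] xs(2-4) ws(2-4) by auto
    then show ?case by blast
  qed
  then show ?thesis by (elim exE conjE) (intro exI conjI, auto)
qed

section \<open>Parity of cut crossings\<close>

fun crossings :: "'a set \<Rightarrow> 'a list \<Rightarrow> nat" where
  "crossings D (x # y # ys) = of_bool ((x \<in> D) \<noteq> (y \<in> D)) + crossings D (y # ys)"
| "crossings D _ = 0"

lemma odd_crossings_iff:
  "xs \<noteq> [] \<Longrightarrow> odd (crossings D xs) \<longleftrightarrow> (hd xs \<in> D) \<noteq> (last xs \<in> D)"
  by (induction D xs rule: crossings.induct) auto

lemma crossings_eq_0D:
  "crossings D xs = 0 \<Longrightarrow> x \<in> set xs \<Longrightarrow> x \<in> D \<longleftrightarrow> hd xs \<in> D"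
  by (induction D xs rule: crossings.induct) (auto split: if_splits)

text \<open>Each crossing switches sides, so a walk that returns to its start crosses an even number
  of times; visiting both sides excludes zero.\<close>

lemma closed_walk_crossings_ge:
  assumes "xs \<noteq> []" "hd xs = last xs" "x \<in> set xs" "x \<in> D" "y \<in> set xs" "y \<notin> D"
  shows "2 \<le> crossings D xs"
proof -
  have "even (crossings D xs)" using odd_crossings_iff[of xs D] assms by auto
  moreover have "crossings D xs \<noteq> 0" using crossings_eq_0D[of D xs] assms by blast
  ultimately show ?thesis by presburger
qed

text \<open>The hypothesis says that the cuts are edge-disjoint, so each step of the walk is charged
  to at most one of them.\<close>

lemma sum_crossings_le:
  assumes "\<And>x y. E x y \<Longrightarrow> (\<Sum>u\<in>U. of_bool ((x \<in> D u) \<noteq> (y \<in> D u))) \<le> (1 :: nat)"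
  shows "successively E xs \<Longrightarrow> (\<Sum>u\<in>U. crossings (D u) xs) \<le> length xs - 1"
proof (induction xs rule: induct_list012)
  case (3 x y zs)
  then show ?case using assms[of x y] by (auto simp: sum.distrib)
qed auto

text \<open>A shortest tour crosses every cut that splits \<open>S\<close> at least twice, and
  edge-disjointness lets these contributions be added. For a tree, the cuts are the subtrees, each
  bounded by a single edge.\<close>

lemma tsp_ge_cuts:
  fixes D :: "'b \<Rightarrow> 'a set"
  assumes "connected_graph V E" "finite S" "S \<subseteq> V" "finite U"
    and cross: "\<And>x y. E x y \<Longrightarrow> (\<Sum>u\<in>U. of_bool ((x \<in> D u) \<noteq> (y \<in> D u))) \<le> (1 :: nat)"
  shows "(\<Sum>u\<in>U. 2 * of_bool (\<not> S \<subseteq> D u \<and> S \<inter> D u \<noteq> {})) \<le> tsp V E S"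
proof -
  have "\<exists>m xs. is_walk V E xs \<and> hd xs = last xs \<and> S \<subseteq> set xs \<and> walk_len xs = m"
    using closed_walk_covering[OF assms(1-3)] by blast
  from LeastI_ex[OF this] obtain xs where xs: "is_walk V E xs" "hd xs = last xs" "S \<subseteq> set xs"
    "walk_len xs = tsp V E S"
    unfolding tsp_def by auto
  have "(\<Sum>u\<in>U. 2 * of_bool (\<not> S \<subseteq> D u \<and> S \<inter> D u \<noteq> {})) \<le> (\<Sum>u\<in>U. crossings (D u) xs)"
  proof (rule sum_mono)
    fix u
    show "2 * of_bool (\<not> S \<subseteq> D u \<and> S \<inter> D u \<noteq> {}) \<le> crossings (D u) xs"
      using closed_walk_crossings_ge[of xs _ "D u"] xs by (auto simp: is_walk_iff)
  qed
  also have "\<dots> \<le> length xs - 1"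
    using sum_crossings_le[OF cross] xs(1) by (auto simp: is_walk_iff)
  finally show ?thesis using xs(4) by (simp add: walk_len_def)
qed

section \<open>Averaging the cut bound over all k-sets\<close>

lemma card_split_subsets_ge:
  assumes "finite V" "D \<subseteq> V"
  shows "card V choose k \<le> card {S. S \<subseteq> V \<and> card S = k \<and> \<not> S \<subseteq> D \<and> S \<inter> D \<noteq> {}}
           + (card D choose k) + ((card V - card D) choose k)"
proof -
  let ?A = "{S. S \<subseteq> V \<and> card S = k \<and> \<not> S \<subseteq> D \<and> S \<inter> D \<noteq> {}}"
  let ?B = "{S. S \<subseteq> D \<and> card S = k}" and ?C = "{S. S \<subseteq> V - D \<and> card S = k}"
  have fin: "finite D" "finite (V - D)" using assms finite_subset by auto
  have "card V choose k = card {S. S \<subseteq> V \<and> card S = k}" using n_subsets[OF assms(1)] by simp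
  \<comment> \<open>A k-set that \<open>D\<close> does not split lies inside \<open>D\<close> or
    inside its complement.\<close>
  also have "\<dots> \<le> card (?A \<union> ?B \<union> ?C)"
    by (rule card_mono) (use assms fin in \<open>auto\<close>)
  also have "\<dots> \<le> card ?A + card ?B + card ?C"
    by (meson add_mono card_Un_le le_refl order_trans)
  also have "\<dots> = card ?A + (card D choose k) + ((card V - card D) choose k)"
    using n_subsets[OF fin(1)] n_subsets[OF fin(2)] assms fin by (simp add: card_Diff_subset)
  finally show ?thesis .
qed

lemma binomial_ratio_eq_prod:
  assumes "k \<le> m" "m \<le> n"
  shows "real (m choose k) / real (n choose k) = (\<Prod>i<k. (real m - real i) / (real n - real i))"
proof -
  have "real (m choose k) / real (n choose k)
      = (\<Prod>i<k. (real (m - i) / real (k - i)) / (real (n - i) / real (k - i)))"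
    using assms by (simp add: binomial_altdef_of_nat prod_dividef atLeast0LessThan)
  also have "\<dots> = (\<Prod>i<k. (real m - real i) / (real n - real i))"
    using assms by (intro prod.cong) (auto simp: of_nat_diff)
  finally show ?thesis .
qed

text \<open>The ratio is a product of factors \<open>(m - i) / (n - i)\<close>, each at most
  \<open>m / n\<close>: avoiding repetitions only lowers the chance that a random k-set falls into a
  given part. For \<open>k > m\<close> the left side is zero.\<close>

lemma binomial_ratio_le_power:
  assumes "m \<le> n" "k \<le> n" "0 < n"
  shows "real (m choose k) / real (n choose k) \<le> (real m / real n) ^ k"
proof (cases "k \<le> m")
  case False
  then show ?thesis by (simp add: binomial_eq_0)
next
  case True
  have "real (m choose k) / real (n choose k) = (\<Prod>i<k. (real m - real i) / (real n - real i))"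
    using binomial_ratio_eq_prod[OF True assms(1)] .
  also have "\<dots> \<le> (\<Prod>i<k. real m / real n)"
  proof (rule prod_mono, safe)
    fix i assume "i < k"
    then have i: "i < m" "i < n" using True assms by auto
    then have "real i * real m \<le> real i * real n" using assms by (intro mult_left_mono) auto
    then show "(real m - real i) / (real n - real i) \<le> real m / real n"
      using i by (simp add: field_simps)
    show "0 \<le> (real m - real i) / (real n - real i)" using i by simp
  qed
  finally show ?thesis by simp
qed

text \<open>Linearity of expectation applied to \<open>tsp_ge_cuts\<close>: each cut contributes
  twice the probability that it splits a random k-set, and that probability is bounded below through
  the two ways of not being split.\<close>

lemma mu_tsp_ge_cuts:
  fixes D :: "'b \<Rightarrow> 'a set"
  assumes "connected_graph V E" "finite V" "finite U" "k \<le> card V"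
    and D: "\<And>u. u \<in> U \<Longrightarrow> D u \<subseteq> V"
    and cross: "\<And>x y. E x y \<Longrightarrow> (\<Sum>u\<in>U. of_bool ((x \<in> D u) \<noteq> (y \<in> D u))) \<le> (1 :: nat)"
  shows "2 * (\<Sum>u\<in>U. 1 - (real (card (D u)) / card V) ^ k - (1 - real (card (D u)) / card V) ^ k)
           \<le> mu_tsp k V E"
proof -
  let ?K = "{S. S \<subseteq> V \<and> card S = k}"
  let ?s = "\<lambda>S u. \<not> S \<subseteq> D u \<and> S \<inter> D u \<noteq> {}"
  let ?n = "card V"
  have finK: "finite ?K" using assms(2) by simp
  have pos: "real (?n choose k) > 0" using assms(4) by simp
  have n0: "0 < ?n" using assms(1,2) by (auto simp: connected_graph_def card_gt_0_iff)
  have cut: "1 - (real (card (D u)) / ?n) ^ k - (1 - real (card (D u)) / ?n) ^ k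
      \<le> real (card {S \<in> ?K. ?s S u}) / real (?n choose k)" if u: "u \<in> U" for u
  proof -
    have c: "card (D u) \<le> ?n" using card_mono[OF assms(2) D[OF u]] .
    have "real (?n choose k) \<le> real (card {S \<in> ?K. ?s S u})
           + real (card (D u) choose k) + real ((?n - card (D u)) choose k)"
      using card_split_subsets_ge[OF assms(2) D[OF u], of k] by (simp add: conj_assoc)
    then have "1 \<le> real (card {S \<in> ?K. ?s S u}) / real (?n choose k)
           + real (card (D u) choose k) / real (?n choose k)
           + real ((?n - card (D u)) choose k) / real (?n choose k)"
      using pos by (simp add: add_divide_distrib[symmetric])
    moreover have "real (card (D u) choose k) / real (?n choose k) \<le> (real (card (D u)) / ?n) ^ k"
      using binomial_ratio_le_power[OF c assms(4) n0] .
    moreover have "real ((?n - card (D u)) choose k) / real (?n choose k)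
        \<le> (1 - real (card (D u)) / ?n) ^ k"
      using binomial_ratio_le_power[of "?n - card (D u)" ?n k] assms(4) n0 c
      by (simp add: of_nat_diff diff_divide_distrib)
    ultimately show ?thesis by linarith
  qed
  have "2 * (\<Sum>u\<in>U. 1 - (real (card (D u)) / ?n) ^ k - (1 - real (card (D u)) / ?n) ^ k)
      \<le> 2 * (\<Sum>u\<in>U. real (card {S \<in> ?K. ?s S u}) / real (?n choose k))"
    using cut by (intro mult_left_mono sum_mono) auto
  also have "\<dots> = (\<Sum>u\<in>U. \<Sum>S\<in>?K. 2 * of_bool (?s S u)) / real (?n choose k)"
    using finK by (simp add: sum_divide_distrib[symmetric] sum_distrib_left[symmetric] sum_of_bool_eq Int_def)
  \<comment> \<open>Double counting: instead of the sets split by each cut, count the cuts splitting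
    each set.\<close>
  also have "\<dots> = (\<Sum>S\<in>?K. real (\<Sum>u\<in>U. 2 * of_bool (?s S u))) / real (?n choose k)"
    by (subst sum.swap) simp
  also have "\<dots> \<le> mu_tsp k V E"
    unfolding mu_tsp_def
  proof (intro divide_right_mono sum_mono)
    fix S assume "S \<in> ?K"
    then have "finite S" "S \<subseteq> V" using assms(2) finite_subset by auto
    then show "real (\<Sum>u\<in>U. 2 * of_bool (?s S u)) \<le> real (tsp V E S)"
      using tsp_ge_cuts[OF assms(1) _ _ assms(3) cross] by (intro of_nat_mono) blast
  qed simp
  finally show ?thesis .
qed

subsection \<open>The tree\<close>

definition parent_adj :: "(nat \<Rightarrow> nat) \<Rightarrow> nat \<Rightarrow> nat \<Rightarrow> nat \<Rightarrow> bool" where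
  "parent_adj p N u v \<longleftrightarrow> u \<le> N \<and> v \<le> N \<and> (0 < v \<and> u = p v \<or> 0 < u \<and> v = p u)"

lemma parent_adj_sym: "parent_adj p N u v \<Longrightarrow> parent_adj p N v u"
  by (auto simp: parent_adj_def)

text \<open>Labels decrease towards the root 0, so strong induction on the label climbs from parent
  to parent; \<open>dep\<close> counts the steps.\<close>

lemma walk_to_root:
  fixes dep :: "nat \<Rightarrow> nat"
  assumes p: "\<And>v. 0 < v \<Longrightarrow> p v < v" and "dep 0 = 0"
    and dep: "\<And>v. 0 < v \<Longrightarrow> dep v = Suc (dep (p v))"
  shows "v \<le> N \<Longrightarrow> \<exists>xs. is_walk {..N} (parent_adj p N) xs \<and> hd xs = v \<and> last xs = 0 \<and> walk_len xs = dep v"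
proof (induction v rule: less_induct)
  case (less v)
  show ?case
  proof (cases "v = 0")
    case True
    then show ?thesis
      by (intro exI[of _ "[0]"]) (auto simp: is_walk_iff walk_len_def assms(2))
  next
    case False
    then obtain xs where xs: "is_walk {..N} (parent_adj p N) xs" "hd xs = p v" "last xs = 0"
      "walk_len xs = dep (p v)"
      using less.IH[of "p v"] p[of v] less.prems by auto
    then have "is_walk {..N} (parent_adj p N) (v # xs)"
      using less.prems p[of v] False
      by (cases xs) (auto simp: is_walk_iff parent_adj_def)
    moreover have "last (v # xs) = 0" "walk_len (v # xs) = dep v"
      using xs dep[of v] False by (cases xs; auto simp: is_walk_iff walk_len_def)+
    ultimately show ?thesis by (intro exI[of _ "v # xs"]) auto
  qed
qed

text \<open>Climb from \<open>u\<close> to the root and descend to \<open>v\<close>. The walk need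
  not be shortest, but it gives both connectivity and the upper bound for the diameter.\<close>

lemma parent_walk:
  fixes dep :: "nat \<Rightarrow> nat"
  assumes "\<And>v. 0 < v \<Longrightarrow> p v < v" and "dep 0 = 0" and "\<And>v. 0 < v \<Longrightarrow> dep v = Suc (dep (p v))"
    and "u \<le> N" "v \<le> N"
  shows "\<exists>xs. is_walk {..N} (parent_adj p N) xs \<and> hd xs = u \<and> last xs = v \<and> walk_len xs = dep u + dep v"
proof -
  obtain xs where xs: "is_walk {..N} (parent_adj p N) xs" "hd xs = u" "last xs = 0" "walk_len xs = dep u"
    using walk_to_root[of p dep u N] assms by auto
  obtain ys where ys: "is_walk {..N} (parent_adj p N) ys" "hd ys = v" "last ys = 0" "walk_len ys = dep v"
    using walk_to_root[of p dep v N] assms by auto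
  have rev: "is_walk {..N} (parent_adj p N) (rev ys)" "walk_len (rev ys) = dep v"
    using is_walk_rev[OF ys(1) parent_adj_sym] ys(4) by auto
  have "ys \<noteq> []" using ys(1) by (auto simp: is_walk_iff)
  then have e: "hd (rev ys) = 0" "last (rev ys) = v" using ys by (auto simp: hd_rev last_rev)
  have "is_walk {..N} (parent_adj p N) (xs @ tl (rev ys)) \<and> hd (xs @ tl (rev ys)) = u
    \<and> last (xs @ tl (rev ys)) = v \<and> walk_len (xs @ tl (rev ys)) = dep u + dep v"
    using is_walk_append[OF xs(1) rev(1)] xs rev e by auto
  then show ?thesis by blast
qed

lemma no_cycle_parent_adj:
  assumes p: "\<And>v. 0 < v \<Longrightarrow> p v < v"
  shows "\<not> has_cycle {..N} (parent_adj p N)"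
proof
  assume "has_cycle {..N} (parent_adj p N)"
  then obtain xs where len: "3 \<le> length xs" and dist: "distinct xs"
    and w: "is_walk {..N} (parent_adj p N) xs" and cl: "parent_adj p N (last xs) (hd xs)"
    unfolding has_cycle_def by blast
  \<comment> \<open>The two cycle neighbours of the largest vertex would both be its parent.\<close>
  define m where "m = Max (set xs)"
  define l where "l = length xs"
  have ne: "xs \<noteq> []" using len by auto
  then have "m \<in> set xs" unfolding m_def by (intro Max_in) auto
  then obtain i where i: "i < l" "xs ! i = m" by (auto simp: in_set_conv_nth l_def)
  have adj: "parent_adj p N (xs ! j) (xs ! (Suc j mod l))" if "j < l" for j
  proof (cases "Suc j < l")
    case True
    then show ?thesis using w by (auto simp: is_walk_def l_def)
  next
    case False
    then have "Suc j = l" using that by auto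
    then have "j = length xs - 1" "Suc j mod l = 0" by (simp_all add: l_def)
    then have "xs ! j = last xs" "xs ! (Suc j mod l) = hd xs"
      using ne by (simp_all only: last_conv_nth hd_conv_nth not_False_eq_True)
    then show ?thesis using cl by simp
  qed
  have parent_max: "x = p m" if "x \<in> set xs" "x \<noteq> m" "parent_adj p N x m" for x
  proof -
    have "x \<le> m" unfolding m_def using that by auto
    then show ?thesis using that p[of x] by (auto simp: parent_adj_def)
  qed
  \<comment> \<open>\<open>a\<close> and \<open>b\<close> are the cyclic successor and predecessor
    of the position of the maximum. They are distinct because the cycle has at least three vertices,
    which is what contradicts the uniqueness of the parent.\<close>
  define a where "a = Suc i mod l"
  define b where "b = (if i = 0 then l - 1 else i - 1)"
  have l3: "3 \<le> l" using len l_def by simp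
  have a: "a = (if Suc i = l then 0 else Suc i)" unfolding a_def using i by auto
  have ab: "a < l" "b < l" "a \<noteq> i" "b \<noteq> i" "a \<noteq> b" "Suc b mod l = i"
    using i l3 by (auto simp: a b_def split: if_splits)
  have "xs ! a \<noteq> xs ! i" "xs ! b \<noteq> xs ! i" "xs ! a \<noteq> xs ! b"
    using dist ab i by (auto simp: nth_eq_iff_index_eq l_def)
  moreover have "parent_adj p N (xs ! a) m"
    using adj[OF i(1)] i(2) parent_adj_sym by (metis a_def)
  moreover have "parent_adj p N (xs ! b) m"
    using adj[OF ab(2)] i(2) ab(6) by simp
  ultimately show False
    using parent_max[of "xs ! a"] parent_max[of "xs ! b"] i(2) ab by (auto simp: l_def)
qed

lemma is_tree_parent_adj:
  assumes p: "\<And>v. 0 < v \<Longrightarrow> p v < v" and "dep 0 = 0"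
    and "\<And>v. 0 < v \<Longrightarrow> dep v = Suc (dep (p v))"
  shows "is_tree {..N} (parent_adj p N)"
proof -
  have "connected_graph {..N} (parent_adj p N)"
    unfolding connected_graph_def
  proof (intro conjI ballI)
    fix u v assume "u \<in> {..N}" "v \<in> {..N}"
    then show "\<exists>xs. is_walk {..N} (parent_adj p N) xs \<and> hd xs = u \<and> last xs = v"
      using parent_walk[of p dep u N v, OF assms] by auto
  qed simp
  moreover have "simple_graph {..N} (parent_adj p N)"
    unfolding simple_graph_def
  proof (intro conjI allI impI)
    fix u v assume uv: "parent_adj p N u v"
    then show "u \<in> {..N}" "v \<in> {..N}" by (simp_all add: parent_adj_def)
    show "u \<noteq> v" using uv p[of u] p[of v] by (auto simp: parent_adj_def)
    show "parent_adj p N v u" using uv by (rule parent_adj_sym)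
  qed simp
  ultimately show ?thesis using no_cycle_parent_adj[of p, OF p] by (simp add: is_tree_def)
qed

text \<open>Let L = d div 2. The tree is a spider with three legs of length L centred at 0, leg i carrying
  the vertices congruent to i modulo 3 (for odd d, one leg is longer by one); the remaining
  d/2 vertices are attached as leaves, spread evenly over the vertices at depth L - 1.
  For 0 < u \<le> 3 L - 3, the subtree below u is the set of larger vertices in the residue class of u.\<close>

definition spider_parent :: "nat \<Rightarrow> nat \<Rightarrow> nat" where
  "spider_parent d v = (if v \<le> 3 then 0 else if v \<le> 3 * (d div 2) + d mod 2 then v - 3
     else 3 * (d div 2 - 2) + 1 + (v - 1) mod 3)"

text \<open>Here \<open>(v + 2) div 3\<close> is v/3 rounded up. An extra leaf hangs below depth L -
  1 and so has depth L = \<open>d div 2\<close>; for odd d only the tip \<open>3 * L + 1\<close> of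
  the longer leg is deeper.\<close>

definition spider_depth :: "nat \<Rightarrow> nat \<Rightarrow> nat" where
  "spider_depth d v = (if v \<le> 3 * (d div 2) + d mod 2 then (v + 2) div 3 else d div 2)"

definition descendants :: "nat \<Rightarrow> nat \<Rightarrow> nat set" where
  "descendants d u = {v. u \<le> v \<and> v \<le> 2 * d \<and> v mod 3 = u mod 3}"

section \<open>Arithmetic of the spider\<close>

lemma mod_eq_imp_add_le:
  fixes m u v :: nat
  assumes "v mod m = u mod m" "u < v"
  shows "u + m \<le> v"
  using assms mod_eq_dvd_iff_nat[of u v m] dvd_imp_le[of m "v - u"] by simp

lemma mod_pred_cong:
  fixes m u v :: nat
  assumes "v mod m = u mod m" "0 < u" "0 < v"
  shows "(v - 1) mod m = (u - 1) mod m"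
  using assms by (cases u; cases v) (auto simp: mod_Suc split: if_splits)

text \<open>An extra leaf is attached to the leg of its own residue class, so residues modulo 3
  still identify the branches at the root.\<close>

lemma leaf_parent_mod: "0 < v \<Longrightarrow> (3 * L + 1 + (v - 1) mod 3) mod 3 = v mod (3 :: nat)"
  by (cases v) (simp_all add: mod_simps)

text \<open>The leaf case writes \<open>d div 2\<close> as \<open>L + 2\<close>, which removes the
  truncated subtraction from the definition of the parent.\<close>

lemma spider_parent_cases [consumes 2, case_names root leg leaf]:
  assumes "4 \<le> d" "0 < v"
  obtains "v \<le> 3" "spider_parent d v = 0" | "3 < v" "v \<le> 3 * (d div 2) + d mod 2" "spider_parent d v = v - 3"
  | L where "d div 2 = L + 2" "3 * L + 6 < v" "3 * (d div 2) + d mod 2 < v"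
      "spider_parent d v = 3 * L + 1 + (v - 1) mod 3"
proof -
  have L: "d div 2 = (d div 2 - 2) + 2" using div_le_mono[OF assms(1), of 2] by simp
  consider "v \<le> 3" | "3 < v" "v \<le> 3 * (d div 2) + d mod 2" | "3 * (d div 2) + d mod 2 < v"
    by linarith
  then show ?thesis
  proof cases
    case 1
    then show ?thesis using that(1) by (simp add: spider_parent_def)
  next
    case 2
    then show ?thesis using that(2) by (simp add: spider_parent_def)
  next
    case 3
    then have "3 * (d div 2 - 2) + 6 < v" using L by linarith
    moreover have "spider_parent d v = 3 * (d div 2 - 2) + 1 + (v - 1) mod 3"
      using 3 calculation by (simp add: spider_parent_def)
    ultimately show ?thesis using that(3)[of "d div 2 - 2"] L 3 by blast
  qed
qed

lemma spider_parent_less: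
  assumes "4 \<le> d" "0 < v"
  shows "spider_parent d v < v"
  using assms
proof (cases rule: spider_parent_cases)
  case (leaf L)
  have "(v - 1) mod 3 < 3" by simp
  then show ?thesis using leaf by linarith
qed (use assms in auto)

lemma spider_depth_0: "spider_depth d 0 = 0"
  by (simp add: spider_depth_def)

lemma spider_depth_Suc:
  assumes "4 \<le> d" "0 < v"
  shows "spider_depth d v = Suc (spider_depth d (spider_parent d v))"
  using assms
proof (cases rule: spider_parent_cases)
  case root
  have "3 \<le> 3 * (d div 2)" using div_le_mono[OF assms(1), of 2] by simp
  then have "v \<le> 3 * (d div 2) + d mod 2" by (intro trans_le_add1 le_trans[OF root(1)])
  moreover have "(v + 2) div 3 = 1" by (rule div_nat_eqI) (use root(1) assms(2) in simp_all)
  ultimately have "spider_depth d v = 1" unfolding spider_depth_def by (simp only: if_True)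
  then show ?thesis unfolding root(2) spider_depth_0 by simp
next
  case leg
  then have "v + 2 = (v - 3 + 2) + 3" by simp
  moreover have "((v - 3 + 2) + 3) div 3 = (v - 3 + 2) div 3 + 1" by (rule div_add_self2) simp
  ultimately have "(v + 2) div 3 = Suc ((v - 3 + 2) div 3)" by (simp only: Suc_eq_plus1)
  moreover have "v - 3 \<le> 3 * (d div 2) + d mod 2" using leg(2) by (rule le_trans[OF diff_le_self])
  ultimately show ?thesis using leg(2) unfolding leg(3) spider_depth_def by (simp only: if_True)
next
  case (leaf L)
  define r where "r = (v - 1) mod 3"
  have r: "spider_parent d v = 3 * L + 1 + r" "r < 3" using leaf by (simp_all add: r_def)
  then have "spider_parent d v + 2 = r + (L + 1) * 3" by simp
  moreover have "(r + (L + 1) * 3) div 3 = L + 1 + r div 3" by (rule div_mult_self1) simp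
  ultimately have "(spider_parent d v + 2) div 3 = L + 1" using r(2) by simp
  moreover have "spider_parent d v \<le> 3 * (d div 2) + d mod 2" unfolding leaf(1) r(1) using r(2) by simp
  ultimately have "spider_depth d (spider_parent d v) = L + 1" by (simp add: spider_depth_def)
  moreover have "spider_depth d v = L + 2" using leaf(3) unfolding spider_depth_def leaf(1) by simp
  ultimately show ?thesis by simp
qed

text \<open>Only the edge from \<open>u\<close> to its parent leaves the set at \<open>u\<close>.
  Leg and leaf edges preserve the residue class, and within a class distinct vertices differ by at
  least 3. The bound on \<open>u\<close> stops at depth L - 1 with L = \<open>d div 2\<close>: for
  the leg vertices at depth L the set would contain leaves that do not hang below
  \<open>u\<close>.\<close>

lemma spider_parent_descendants_iff:
  assumes "4 \<le> d" "0 < v" "v \<le> 2 * d" "0 < u" "u \<le> 3 * (d div 2) - 3" "v \<noteq> u"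
  shows "spider_parent d v \<in> descendants d u \<longleftrightarrow> v \<in> descendants d u"
proof -
  have le: "spider_parent d v \<le> 2 * d" using spider_parent_less[of d v] assms by simp
  have cut: "w \<in> descendants d u \<longleftrightarrow> u \<le> w \<and> w mod 3 = u mod 3" if "w \<le> 2 * d" for w
    using that by (auto simp: descendants_def)
  show ?thesis
    unfolding cut[OF le] cut[OF assms(3)]
    using assms(1,2)
  proof (cases rule: spider_parent_cases)
    case root
    have "\<not> (u \<le> v \<and> v mod 3 = u mod 3)"
    proof
      assume "u \<le> v \<and> v mod 3 = u mod 3"
      then have "u + 3 \<le> v" using mod_eq_imp_add_le[of v 3 u] assms(6) by linarith
      then show False using root(1) assms(4) by linarith
    qed
    moreover have "\<not> u \<le> spider_parent d v" using root(2) assms(4) by linarith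
    ultimately show "(u \<le> spider_parent d v \<and> spider_parent d v mod 3 = u mod 3)
        \<longleftrightarrow> (u \<le> v \<and> v mod 3 = u mod 3)"
      by blast
  next
    case leg
    have "3 \<le> v" using leg(1) by linarith
    from le_mod_geq[OF this] have m: "spider_parent d v mod 3 = v mod 3" unfolding leg(3) by (rule sym)
    have "u \<le> spider_parent d v \<longleftrightarrow> u \<le> v" if "v mod 3 = u mod 3"
      using mod_eq_imp_add_le[OF that] assms(6) leg(1,3) by linarith
    then show "(u \<le> spider_parent d v \<and> spider_parent d v mod 3 = u mod 3)
        \<longleftrightarrow> (u \<le> v \<and> v mod 3 = u mod 3)"
      unfolding m by blast
  next
    case (leaf L)
    have m: "spider_parent d v mod 3 = v mod 3"
      unfolding leaf(4) by (rule leaf_parent_mod[OF assms(2)])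
    have u: "u \<le> 3 * L + 3" using assms(5) unfolding leaf(1) by simp
    \<comment> \<open>With \<open>u - 1 = 3 * q + r\<close>, the vertex \<open>u\<close> sits at
      level \<open>q + 1\<close> of its leg. The leaf's parent is on the same leg at level
      \<open>L + 1\<close>, and \<open>q \<le> L\<close>.\<close>
    have "u \<le> spider_parent d v" if "v mod 3 = u mod 3"
    proof -
      have r: "(v - 1) mod 3 = (u - 1) mod 3" using that assms(4,2) by (rule mod_pred_cong)
      obtain q where q: "u - 1 = 3 * q + (u - 1) mod 3" using mult_div_mod_eq[of 3 "u - 1"] by metis
      obtain r where r: "u - 1 = 3 * q + r" "spider_parent d v = 3 * L + 1 + r"
        using q leaf(4) unfolding r by blast
      then have "3 * q < 3 * (L + 1)" using u by simp
      then have "q \<le> L" by arith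
      then show ?thesis using r assms(4) by arith
    qed
    moreover have "u \<le> v" using u leaf(2) by linarith
    ultimately show "(u \<le> spider_parent d v \<and> spider_parent d v mod 3 = u mod 3)
        \<longleftrightarrow> (u \<le> v \<and> v mod 3 = u mod 3)"
      unfolding m by blast
  qed
qed

text \<open>The edge-disjointness needed for the cut bound: an edge crosses no cut except possibly
  the one indexed by its child end.\<close>

lemma sum_descendants_crossings_le:
  assumes "4 \<le> d" "parent_adj (spider_parent d) (2 * d) x y"
  shows "(\<Sum>u\<in>{1..3 * (d div 2) - 3}. of_bool ((x \<in> descendants d u) \<noteq> (y \<in> descendants d u))) \<le> (1 :: nat)"
proof -
  have main: "(\<Sum>u\<in>{1..3 * (d div 2) - 3}.
      of_bool ((v \<in> descendants d u) \<noteq> (spider_parent d v \<in> descendants d u))) \<le> (1 :: nat)"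
    if v: "0 < v" "v \<le> 2 * d" for v
  proof -
    have "(\<Sum>u\<in>{1..3 * (d div 2) - 3}.
          of_bool ((v \<in> descendants d u) \<noteq> (spider_parent d v \<in> descendants d u)))
        \<le> (\<Sum>u\<in>{1..3 * (d div 2) - 3}. if u = v then 1 else (0 :: nat))"
    proof (rule sum_mono)
      fix u assume "u \<in> {1..3 * (d div 2) - 3}"
      then have "0 < u" "u \<le> 3 * (d div 2) - 3" by simp_all
      then show "of_bool ((v \<in> descendants d u) \<noteq> (spider_parent d v \<in> descendants d u))
          \<le> (if u = v then 1 else (0 :: nat))"
        using spider_parent_descendants_iff[OF assms(1) v, of u] by (cases "u = v") (simp_all add: of_bool_def)
    qed
    also have "\<dots> \<le> 1" by (subst sum.delta) simp_all
    finally show ?thesis .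
  qed
  have swap: "(\<Sum>u\<in>{1..3 * (d div 2) - 3}. of_bool ((x \<in> descendants d u) \<noteq> (y \<in> descendants d u)))
      = (\<Sum>u\<in>{1..3 * (d div 2) - 3}. of_bool ((y \<in> descendants d u) \<noteq> (x \<in> descendants d u)) :: nat)"
    by (rule sum.cong) auto
  from assms(2) consider "0 < y" "y \<le> 2 * d" "x = spider_parent d y" | "0 < x" "x \<le> 2 * d" "y = spider_parent d x"
    unfolding parent_adj_def by blast
  then show ?thesis
  proof cases
    case 1
    show ?thesis unfolding swap unfolding 1(3) by (rule main[OF 1(1,2)])
  next
    case 2
    show ?thesis unfolding 2(3) by (rule main[OF 2(1,2)])
  qed
qed

text \<open>The set is an arithmetic progression with difference 3 starting at
  \<open>u\<close>.\<close>

lemma card_descendants: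
  assumes "u \<le> 2 * d"
  shows "card (descendants d u) = (2 * d - u) div 3 + 1"
proof -
  have "descendants d u = (\<lambda>j. u + 3 * j) ` {..(2 * d - u) div 3}"
  proof (intro equalityI subsetI)
    fix v assume "v \<in> descendants d u"
    then have v: "u \<le> v" "v \<le> 2 * d" "v mod 3 = u mod 3" by (simp_all add: descendants_def)
    then obtain j where j: "v - u = 3 * j" using mod_eq_dvd_iff_nat[of u v 3] by (auto elim: dvdE)
    have "j = (v - u) div 3" unfolding j by simp
    also have "\<dots> \<le> (2 * d - u) div 3" using v(2) by (intro div_le_mono diff_le_mono)
    finally show "v \<in> (\<lambda>j. u + 3 * j) ` {..(2 * d - u) div 3}"
      using j v(1) by (intro image_eqI[of _ _ j]) simp_all
  next
    fix v assume "v \<in> (\<lambda>j. u + 3 * j) ` {..(2 * d - u) div 3}"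
    then obtain j where j: "j \<le> (2 * d - u) div 3" "v = u + 3 * j" by blast
    have "3 * j \<le> 3 * ((2 * d - u) div 3)" using j(1) by (rule mult_le_mono2)
    also have "\<dots> \<le> 2 * d - u" by (rule times_div_less_eq_dividend)
    finally show "v \<in> descendants d u" using assms j(2) by (simp add: descendants_def)
  qed
  moreover have "inj_on (\<lambda>j. u + 3 * j) {..(2 * d - u) div 3}" by (auto simp: inj_on_def)
  ultimately show ?thesis by (simp add: card_image)
qed

section \<open>Tree property and diameter of the spider\<close>

lemma is_tree_spider:
  assumes "4 \<le> d"
  shows "is_tree {..2 * d} (parent_adj (spider_parent d) (2 * d))"
  using spider_parent_less[OF assms] spider_depth_0 spider_depth_Suc[OF assms] by (rule is_tree_parent_adj)

lemma diameter_spider: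
  assumes d: "4 \<le> d"
  shows "diameter {..2 * d} (parent_adj (spider_parent d) (2 * d)) = d"
proof -
  let ?E = "parent_adj (spider_parent d) (2 * d)" and ?V = "{..2 * d}"
  let ?L = "d div 2"
  have conn: "connected_graph ?V ?E" using is_tree_spider[OF d] by (simp add: is_tree_def)
  have upper: "graph_dist ?V ?E u v \<le> d" if uv: "u \<in> ?V" "v \<in> ?V" for u v
  \<comment> \<open>Equal vertices are separated off because the tip of the longer leg for odd d has
    twice its depth equal to d + 1.\<close>
  proof (cases "u = v")
    case True
    have "is_walk ?V ?E [u]" using uv by (auto simp: is_walk_iff)
    then have "graph_dist ?V ?E u u \<le> 0"
      using graph_dist_le[of ?V ?E "[u]"] by (simp add: walk_len_def)
    then show ?thesis using True by simp
  next
    case False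
    obtain xs where "is_walk ?V ?E xs" "hd xs = u" "last xs = v"
        "walk_len xs = spider_depth d u + spider_depth d v"
      using parent_walk[of "spider_parent d" "spider_depth d" u "2 * d" v,
          OF spider_parent_less[OF d] spider_depth_0 spider_depth_Suc[OF d]] uv
      by auto
    then have "graph_dist ?V ?E u v \<le> spider_depth d u + spider_depth d v"
      using graph_dist_le by metis
    also have "\<dots> \<le> d"
    proof -
      define L where "L = d div 2"
      have "d = 2 * L + d mod 2" unfolding L_def by simp
      \<comment> \<open>At most one vertex has depth L + 1, and only for odd d; so two distinct
        vertices have depths adding up to at most 2 L + d mod 2.\<close>
      have le: "spider_depth d w \<le> L + (if w = 3 * L + 1 then d mod 2 else 0)" for w
      proof (cases "w \<le> 3 * L")
        case True
        then have "(w + 2) div 3 \<le> L" by presburger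
        then show ?thesis using True by (simp add: spider_depth_def L_def)
      next
        case False
        then show ?thesis by (auto simp: spider_depth_def simp flip: L_def)
      qed
      show ?thesis
        using le[of u] le[of v] False \<open>d = 2 * L + d mod 2\<close> by (auto split: if_splits)
    qed
    finally show ?thesis .
  qed
  \<comment> \<open>Depth with a sign that separates one branch from the other two. It vanishes at
    the root, where branches meet, and therefore changes by 1 along every edge.\<close>
  define \<phi> :: "nat \<Rightarrow> int"
    where "\<phi> v = (if v mod 3 = 1 then int (spider_depth d v) else - int (spider_depth d v))" for v
  have spider_parent_mod: "spider_parent d v = 0 \<or> spider_parent d v mod 3 = v mod 3" if "0 < v" for v
    using d that
  proof (cases rule: spider_parent_cases)
    case leg
    then have "3 \<le> v" by linarith
    from le_mod_geq[OF this] show ?thesis unfolding leg(3) by (intro disjI2) (rule sym)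
  next
    case (leaf L)
    then show ?thesis using that leaf_parent_mod[of v L] by simp
  qed simp
  have step: "\<bar>\<phi> (spider_parent d v) - \<phi> v\<bar> \<le> 1" if "0 < v" for v
    using spider_parent_mod[OF that] spider_depth_Suc[OF d that] spider_depth_0[of d] unfolding \<phi>_def by auto
  have lip: "\<bar>\<phi> u - \<phi> v\<bar> \<le> 1" if "?E u v" for u v
    using that step[of u] step[of v] unfolding parent_adj_def by (auto simp: abs_minus_commute)
  \<comment> \<open>The tips of two different legs: \<open>a\<close> on the leg of residue 1, which
    is the longer one for odd d, and \<open>b\<close> on the leg of residue 0. Their depths add up
    to d.\<close>
  define a where "a = (if even d then 3 * (?L - 1) + 1 else 3 * ?L + 1)"
  define b where "b = 3 * ?L"
  have d2: "d = 2 * ?L + d mod 2" "2 \<le> ?L" using d by presburger+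
  have ab: "a \<in> ?V" "b \<in> ?V" unfolding a_def b_def using d2 by auto
  have "\<bar>\<phi> a - \<phi> b\<bar> = int d"
  proof -
    have "a mod 3 = 1" "b mod 3 \<noteq> 1" unfolding a_def b_def by simp_all
    moreover have "spider_depth d a + spider_depth d b = d"
    proof (cases "even d")
      case True
      then have "a + 2 = 3 * ?L" "2 * ?L = d"
        unfolding a_def using d2(2) by auto
      then have "(a + 2) div 3 = ?L" "(b + 2) div 3 = ?L" "a \<le> 3 * ?L"
        unfolding b_def by auto
      then have "spider_depth d a = ?L" "spider_depth d b = ?L"
        using True by (simp_all add: spider_depth_def b_def)
      then show ?thesis using \<open>2 * ?L = d\<close> by linarith
    next
      case False
      then have "d mod 2 = 1" by presburger
      moreover have "(b + 2) div 3 = ?L" unfolding b_def by simp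
      ultimately have "spider_depth d a = ?L + 1" "spider_depth d b = ?L"
        using False by (simp_all add: spider_depth_def a_def b_def)
      then show ?thesis using d2(1) \<open>d mod 2 = 1\<close> by linarith
    qed
    ultimately show ?thesis unfolding \<phi>_def by auto
  qed
  then have dist: "graph_dist ?V ?E a b = d"
    using graph_dist_ge[OF conn ab, of \<phi>, OF lip] upper[OF ab] by simp
  have "finite ((\<lambda>(u, v). graph_dist ?V ?E u v) ` (?V \<times> ?V))" by simp
  also have "(\<lambda>(u, v). graph_dist ?V ?E u v) ` (?V \<times> ?V)
      = {graph_dist ?V ?E u v |u v. u \<in> ?V \<and> v \<in> ?V}"
    by auto
  finally have fin: "finite {graph_dist ?V ?E u v |u v. u \<in> ?V \<and> v \<in> ?V}" .
  show ?thesis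
    unfolding diameter_def
  proof (rule Max_eqI[OF fin])
    show "d \<in> {graph_dist ?V ?E u v |u v. u \<in> ?V \<and> v \<in> ?V}"
      by (intro CollectI exI[of _ a] exI[of _ b] conjI dist[symmetric] ab)
  next
    fix y assume "y \<in> {graph_dist ?V ?E u v |u v. u \<in> ?V \<and> v \<in> ?V}"
    then show "y \<le> d" using upper by (elim CollectE exE conjE) simp
  qed
qed

subsection \<open>The cycle\<close>

lemma tsp_le:
  "is_walk V E xs \<Longrightarrow> hd xs = last xs \<Longrightarrow> S \<subseteq> set xs \<Longrightarrow> tsp V E S \<le> walk_len xs"
  unfolding tsp_def by (rule Least_le) blast

lemma cycle_adj_sym: "cycle_adj n u v \<Longrightarrow> cycle_adj n v u"
  by (auto simp: cycle_adj_def)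

lemma cycle_adj_Suc: "2 \<le> n \<Longrightarrow> cycle_adj n (x mod n) (Suc x mod n)"
  using mod_less_divisor[of n "Suc x"] by (auto simp: cycle_adj_def mod_Suc)

text \<open>Positions run through the natural numbers and are reduced modulo n only at the end, so
  an arc may wrap around without a case distinction.\<close>

lemma is_walk_cycle_arc:
  assumes "2 \<le> n" "a \<le> b"
  shows "is_walk {0..<n} (cycle_adj n) (map (\<lambda>i. i mod n) [a..<Suc b])"
  unfolding is_walk_def
proof (intro conjI allI impI)
  fix i assume "Suc i < length (map (\<lambda>i. i mod n) [a..<Suc b])"
  then show "cycle_adj n (map (\<lambda>i. i mod n) [a..<Suc b] ! i) (map (\<lambda>i. i mod n) [a..<Suc b] ! Suc i)"
    using cycle_adj_Suc[OF assms(1), of "a + i"] by (simp del: upt_Suc)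
qed (use assms in auto)

lemma tsp_cycle_le_order:
  assumes "2 \<le> n" "S \<subseteq> {0..<n}"
  shows "tsp {0..<n} (cycle_adj n) S \<le> n"
proof -
  let ?xs = "map (\<lambda>i. i mod n) [0..<Suc n]"
  have "{0..<n} \<subseteq> set ?xs"
  proof
    fix x assume "x \<in> {0..<n}"
    then have "x = x mod n" "x \<in> set [0..<Suc n]" by auto
    then show "x \<in> set ?xs" by (metis image_eqI list.set_map)
  qed
  moreover have "hd ?xs = last ?xs" by (simp add: hd_map del: upt_Suc) (simp add: last_map)
  ultimately show ?thesis
    using tsp_le[OF is_walk_cycle_arc[of n 0 n]] assms by (simp add: walk_len_def del: upt_Suc)
qed

text \<open>Walk along the arc and back again.\<close>

lemma tsp_cycle_le_arc:
  assumes "2 \<le> n" "a \<le> b" "S \<subseteq> (\<lambda>i. i mod n) ` {a..b}"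
  shows "tsp {0..<n} (cycle_adj n) S \<le> 2 * (b - a)"
proof -
  define xs where "xs = map (\<lambda>i. i mod n) [a..<Suc b]"
  have xs: "is_walk {0..<n} (cycle_adj n) xs" "xs \<noteq> []" "walk_len xs = b - a"
    "set xs = (\<lambda>i. i mod n) ` {a..b}"
    using is_walk_cycle_arc[OF assms(1,2)] assms(2)
    by (auto simp: xs_def walk_len_def simp del: upt_Suc)
  note r = is_walk_rev[OF xs(1) cycle_adj_sym]
  have "last xs = hd (rev xs)" by (simp add: hd_rev)
  note app = is_walk_append[OF xs(1) r(1) this]
  have "tsp {0..<n} (cycle_adj n) S \<le> walk_len (xs @ tl (rev xs))"
    using app xs assms(3) by (intro tsp_le) (auto simp: last_rev)
  then show ?thesis using app(4) r(2) xs(3) by simp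
qed

section \<open>Arcs of the cycle that avoid the chosen set\<close>

definition arc :: "nat \<Rightarrow> nat \<Rightarrow> nat \<Rightarrow> nat set" where
  "arc n m v = (\<lambda>i. (v + i) mod n) ` {..<m}"

lemma cycle_offset:
  assumes "s < n" "x < n"
  obtains j where "j < n" "x = (s + j) mod (n :: nat)"
proof
  show "(x + n - s) mod n < n" using assms by simp
  have "(s + (x + n - s) mod n) mod n = (s + (x + n - s)) mod n" by (simp add: mod_simps)
  then show "x = (s + (x + n - s) mod n) mod n" using assms by simp
qed

text \<open>If a gap of S contains r \<ge> d free vertices in a row, the tour turns back at both ends of
  the gap, and exactly r - d + 1 free arcs of d vertices fit into the gap.\<close>

lemma tsp_cycle_free_arcs_le:
  assumes n: "n = 2 * d + 1" and d: "1 \<le> d" and S: "S \<subseteq> {0..<n}" "S \<noteq> {}"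
  shows "tsp {0..<n} (cycle_adj n) S + 2 * card {v \<in> {0..<n}. arc n d v \<inter> S = {}} \<le> n + 1"
proof -
  define B where "B = {v \<in> {0..<n}. arc n d v \<inter> S = {}}"
  obtain s where s: "s \<in> S" "s < n" using S by (metis atLeastLessThan_iff equals0I subsetD)
  \<comment> \<open>The cycle is cut open at \<open>s\<close>, and \<open>T\<close> is
    \<open>S\<close> in the resulting linear coordinates. Both 0 and n represent \<open>s\<close>,
    so every gap has an element of \<open>T\<close> on either side and no free arc wraps
    around.\<close>
  define T where "T = {j. j \<le> n \<and> (s + j) mod n \<in> S}"
  define B' where "B' = {v. v < n \<and> {v..<v + d} \<inter> T = {}}"
  have T: "finite T" "0 \<in> T" "n \<in> T" using s by (auto simp: T_def)
  have B': "1 \<le> v" "v + d \<le> n" if "v \<in> B'" for v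
  proof -
    have "v < n" "0 \<notin> {v..<v + d}" "n \<notin> {v..<v + d}" using that T unfolding B'_def by blast+
    then show "1 \<le> v" "v + d \<le> n" using d by auto
  qed
  have "B \<subseteq> (\<lambda>v. (s + v) mod n) ` B'"
  proof
    fix x assume x: "x \<in> B"
    then obtain v where v: "v < n" "x = (s + v) mod n"
      using cycle_offset[of s n x] s by (auto simp: B_def)
    have "j \<notin> T" if "v \<le> j" "j < v + d" for j
    proof -
      have "(s + j) mod n = (x + (j - v)) mod n"
        using that unfolding v(2) mod_add_left_eq by simp
      then have "(s + j) mod n \<in> arc n d x"
        using that unfolding arc_def by (intro image_eqI[of _ _ "j - v"]) auto
      then show ?thesis using x by (auto simp: B_def T_def)
    qed
    then have "v \<in> B'" using v by (auto simp: B'_def)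
    then show "x \<in> (\<lambda>v. (s + v) mod n) ` B'" using v by blast
  qed
  moreover have "finite B'" by (simp add: B'_def)
  ultimately have card: "card B \<le> card B'" by (meson surj_card_le)
  have "tsp {0..<n} (cycle_adj n) S + 2 * card B' \<le> n + 1"
  proof (cases "B' = {}")
    case True
    then show ?thesis using tsp_cycle_le_order[of n S] n d S by simp
  next
    case False
    then obtain v where v: "v \<in> B'" by blast
    \<comment> \<open>The two elements of \<open>T\<close> that bound the gap containing a free
      arc.\<close>
    define a where "a = Max {t \<in> T. t < v}"
    define b where "b = Min {t \<in> T. v \<le> t}"
    have "a \<in> {t \<in> T. t < v}" unfolding a_def using T B'[OF v] by (intro Max_in) auto
    moreover have "b \<in> {t \<in> T. v \<le> t}" unfolding b_def using T B'[OF v] by (intro Min_in) auto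
    ultimately have ab: "a \<in> T" "a < v" "b \<in> T" "v \<le> b" by auto
    have bd: "v + d \<le> b" using ab v by (force simp: B'_def)
    have bn: "b \<le> n" using ab by (simp add: T_def)
    have gap: "t \<le> a \<or> b \<le> t" if "t \<in> T" for t
    proof (cases "t < v")
      case True
      then show ?thesis unfolding a_def using T that by (intro disjI1 Max_ge) auto
    next
      case False
      then show ?thesis unfolding b_def using T that by (intro disjI2 Min_le) auto
    qed
    \<comment> \<open>All free arcs lie in this one gap: two gaps with d free positions each, the
      ends 0 and n, and an element of \<open>T\<close> in between would force
      \<open>n \<ge> 2 * d + 2\<close>.\<close>
    have "B' \<subseteq> {a<..b - d}"
    proof
      fix w assume w: "w \<in> B'"
      have "a \<notin> {w..<w + d}" "b \<notin> {w..<w + d}"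
        using w ab unfolding B'_def by blast+
      moreover note B'[OF w] B'[OF v] ab(2) bd n
      ultimately show "w \<in> {a<..b - d}" by auto
    qed
    then have "card B' \<le> b - d - a" using card_mono[of "{a<..b - d}" B'] by simp
    \<comment> \<open>The tour goes back and forth on the complement of the gap, of length n - (b -
      a). Adding twice the at most b - d - a free arcs leaves 2 (n - d) = n + 1.\<close>
    moreover have "tsp {0..<n} (cycle_adj n) S \<le> 2 * ((s + n + a) - (s + b))"
    proof (rule tsp_cycle_le_arc)
      show "S \<subseteq> (\<lambda>i. i mod n) ` {s + b..s + n + a}"
      proof
        fix x assume x: "x \<in> S"
        then obtain j where j: "j < n" "x = (s + j) mod n"
          using cycle_offset[of s n x] s(2) subsetD[OF S(1) x] by auto
        have "j \<le> a \<or> b \<le> j" using gap[of j] j x by (auto simp: T_def)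
        then show "x \<in> (\<lambda>i. i mod n) ` {s + b..s + n + a}"
        proof
          \<comment> \<open>Positions up to \<open>a\<close> are reached after passing
            \<open>s\<close> again, hence the shift by n.\<close>
          assume "j \<le> a"
          then have "s + j + n \<in> {s + b..s + n + a}" using bn by simp
          moreover have "x = (s + j + n) mod n" using j by simp
          ultimately show ?thesis by blast
        next
          assume "b \<le> j"
          then have "s + j \<in> {s + b..s + n + a}" using j by simp
          then show ?thesis using j by blast
        qed
      qed
    qed (use n d bn in auto)
    ultimately show ?thesis using bd ab(2) bn n by linarith
  qed
  then show ?thesis using card unfolding B_def by linarith
qed

text \<open>The bound on a single tour is averaged by counting, for each of the n arcs, the k-sets
  that avoid it; these are chosen from at least n - d = d + 1 vertices.\<close>

lemma mu_tsp_cycle_le: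
  assumes n: "n = 2 * d + 1" and d: "1 \<le> d" and k: "1 \<le> k" "k \<le> n"
  shows "mu_tsp k {0..<n} (cycle_adj n) \<le> n + 1 - 2 * n * (real ((d + 1) choose k) / real (n choose k))"
proof -
  let ?K = "{S. S \<subseteq> {0..<n} \<and> card S = k}"
  let ?c = "real (n choose k)"
  have pos: "0 < ?c" using k by simp
  have cK: "real (card ?K) = ?c" using n_subsets[of "{0..<n}" k] by simp
  have "mu_tsp k {0..<n} (cycle_adj n)
      \<le> (\<Sum>S\<in>?K. real (n + 1) - 2 * (\<Sum>v\<in>{0..<n}. of_bool (arc n d v \<inter> S = {}))) / ?c"
    unfolding mu_tsp_def card_atLeastLessThan diff_zero
  proof (intro divide_right_mono sum_mono)
    fix S assume S: "S \<in> ?K"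
    then have "S \<noteq> {}" using k by auto
    then have "tsp {0..<n} (cycle_adj n) S + 2 * card {v \<in> {0..<n}. arc n d v \<inter> S = {}} \<le> n + 1"
      using tsp_cycle_free_arcs_le[OF n d] S by auto
    then have "real (tsp {0..<n} (cycle_adj n) S) + 2 * real (card {v \<in> {0..<n}. arc n d v \<inter> S = {}})
        \<le> real (n + 1)"
      by linarith
    moreover have "(\<Sum>v\<in>{0..<n}. of_bool (arc n d v \<inter> S = {})) = real (card {v \<in> {0..<n}. arc n d v \<inter> S = {}})"
      by (simp add: sum_of_bool_eq Int_def)
    ultimately show "real (tsp {0..<n} (cycle_adj n) S)
        \<le> real (n + 1) - 2 * (\<Sum>v\<in>{0..<n}. of_bool (arc n d v \<inter> S = {}))"
      by linarith
  qed simp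
  also have "\<dots> = (real (n + 1) * ?c - 2 * (\<Sum>v\<in>{0..<n}. \<Sum>S\<in>?K. of_bool (arc n d v \<inter> S = {}))) / ?c"
    by (subst sum.swap) (simp add: sum_subtractf sum_distrib_left[symmetric] cK del: of_nat_add)
  also have "\<dots> \<le> (real (n + 1) * ?c - 2 * (\<Sum>v\<in>{0..<n}. real ((d + 1) choose k))) / ?c"
  proof (intro divide_right_mono diff_left_mono mult_left_mono sum_mono)
    fix v
    \<comment> \<open>An upper bound on the size suffices, since a smaller arc is avoided by more
      sets.\<close>
    have "card (arc n d v) \<le> d" unfolding arc_def by (metis card_image_le card_lessThan finite_lessThan)
    moreover have "card {0..<n} - card (arc n d v) \<le> card ({0..<n} - arc n d v)"
      by (rule diff_card_le_card_Diff) (simp add: arc_def)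
    ultimately have "d + 1 \<le> card ({0..<n} - arc n d v)" using n by simp
    then have "(d + 1) choose k \<le> card ({0..<n} - arc n d v) choose k" by (rule binomial_right_mono)
    also have "\<dots> = card {S. S \<subseteq> {0..<n} - arc n d v \<and> card S = k}" by (simp add: n_subsets)
    also have "{S. S \<subseteq> {0..<n} - arc n d v \<and> card S = k} = {S \<in> ?K. arc n d v \<inter> S = {}}" by auto
    finally show "real ((d + 1) choose k) \<le> (\<Sum>S\<in>?K. of_bool (arc n d v \<inter> S = {}))"
      by (simp add: sum_of_bool_eq Int_def)
  qed simp_all
  also have "\<dots> = n + 1 - 2 * n * (real ((d + 1) choose k) / ?c)"
    using pos by (simp add: diff_divide_distrib)
  finally show ?thesis by simp
qed

subsection \<open>Asymptotics\<close>

text \<open>The right side is the integral of (k + 1) t^k over [x, x + 1], where the integrand is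
  least at x. Telescoping this compares the power sums below with integrals.\<close>

lemma power_Suc_diff_ge:
  fixes x :: real
  assumes "0 \<le> x"
  shows "real (k + 1) * x ^ k \<le> (x + 1) ^ (k + 1) - x ^ (k + 1)"
proof (induction k)
  case (Suc k)
  have "0 \<le> real (k + 1) * x ^ k" using assms by simp
  then have "x ^ (Suc k + 1) + real (Suc k + 1) * x ^ Suc k
      \<le> (x + 1) * (x ^ (k + 1) + real (k + 1) * x ^ k)"
    by (simp add: algebra_simps)
  also have "\<dots> \<le> (x + 1) * (x + 1) ^ (k + 1)"
    using Suc.IH assms by (intro mult_left_mono) auto
  finally show ?case by (simp add: algebra_simps)
qed simp

lemma sum_power_shift_le:
  fixes a :: real
  assumes "0 \<le> a"
  shows "real (k + 1) * (\<Sum>u=1..m. (a + real u) ^ k) \<le> (a + 1 + real m) ^ (k + 1) - (a + 1) ^ (k + 1)"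
proof (induction m)
  case (Suc m)
  have "real (k + 1) * (a + 1 + real m) ^ k
      \<le> (a + 1 + real m + 1) ^ (k + 1) - (a + 1 + real m) ^ (k + 1)"
    using assms by (intro power_Suc_diff_ge) simp
  with Suc show ?case by (simp add: algebra_simps)
qed simp

text \<open>The decreasing counterpart of the previous sum; \<open>real m \<le> c\<close> keeps all
  bases nonnegative.\<close>

lemma sum_power_reflect_le:
  fixes c :: real
  shows "real m \<le> c \<Longrightarrow> real (k + 1) * (\<Sum>u=1..m. (c - real u) ^ k) \<le> c ^ (k + 1) - (c - real m) ^ (k + 1)"
proof (induction m)
  case (Suc m)
  have "real (k + 1) * (c - real (Suc m)) ^ k
      \<le> (c - real (Suc m) + 1) ^ (k + 1) - (c - real (Suc m)) ^ (k + 1)"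
    using Suc.prems by (intro power_Suc_diff_ge) simp
  with Suc show ?case by (simp add: algebra_simps)
qed simp

text \<open>Twice the number t of cuts per vertex, minus 6 times the integrals of x^m over [b, a]
  and over [e, c]. The first integral accounts for the complements of the subtrees and the second
  for the subtrees. The relative subtree size falls by 1/(3 n) per step of \<open>u\<close> on
  average, so a sum over \<open>u\<close> is about 3 n times an integral.\<close>

definition profile :: "nat \<Rightarrow> real \<Rightarrow> real \<Rightarrow> real \<Rightarrow> real \<Rightarrow> real \<Rightarrow> real" where
  "profile m t a b c e = 2 * (t - 3 / real (m + 1) * (a ^ (m + 1) - b ^ (m + 1) + c ^ (m + 1) - e ^ (m + 1)))"

text \<open>The finite-d version of the limit constant: the endpoints carry the rounding errors of
  the subtree sizes and of the comparison with integrals.\<close>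

definition spider_bound :: "nat \<Rightarrow> nat \<Rightarrow> real" where
  "spider_bound m d = (let n = 2 * real d + 1; U = real (3 * (d div 2) - 3) in
     profile m (U / n) ((4 * real d + 3 + U) / (3 * n)) ((4 * real d + 3) / (3 * n))
       ((2 * real d + 3) / (3 * n)) ((2 * real d + 3 - U) / (3 * n)))"

text \<open>Subtree sizes relative to n lie in [0, 1], so lowering the exponent from
  \<open>k\<close> to \<open>m\<close> only enlarges the subtracted powers. Hence one fixed exponent
  can later serve all large \<open>k\<close>.\<close>

lemma mu_tsp_spider_ge:
  assumes d: "4 \<le> d" and k: "k \<le> 2 * d + 1" and m: "m \<le> k"
  shows "(2 * real d + 1) * spider_bound m d \<le> mu_tsp k {..2 * d} (parent_adj (spider_parent d) (2 * d))"
proof -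
  define n where "n = 2 * real d + 1"
  define U where "U = 3 * (d div 2) - 3"
  let ?x = "\<lambda>u. real (card (descendants d u)) / n"
  have n: "real (card {..2 * d}) = n" "0 < n" by (simp_all add: n_def)
  have U: "U \<le> 2 * d"
  proof -
    have "2 * (d div 2) \<le> d" by (rule times_div_less_eq_dividend)
    then show ?thesis unfolding U_def by linarith
  qed
  define A where "A = (\<Sum>u=1..U. ((4 * real d + 2) + real u) ^ m)"
  define B where "B = (\<Sum>u=1..U. ((2 * real d + 3) - real u) ^ m)"
  have cut_bound: "1 - (((2 * real d + 3) - real u) / (3 * n)) ^ m - (((4 * real d + 2) + real u) / (3 * n)) ^ m
      \<le> 1 - ?x u ^ k - (1 - ?x u) ^ k" if u: "u \<in> {1..U}" for u
  proof -
    define q where "q = (2 * d - u) div 3"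
    have c: "card (descendants d u) = q + 1" using card_descendants[of u d] u U by (simp add: q_def)
    \<comment> \<open>Both rounding directions are needed: the upper bound on \<open>q\<close> for
      the subtree, the lower bound for its complement. The strict inequality is sharpened by 1
      because all quantities are integers.\<close>
    have "3 * q \<le> 2 * d - u" "2 * d - u < 3 * q + 3" unfolding q_def by simp_all
    then have q: "3 * real q + real u \<le> 2 * real d" "2 * real d < 3 * real q + real u + 3"
      "2 * real d + 1 \<le> 3 * real q + real u + 3"
      using u U by (auto simp flip: of_nat_add of_nat_mult)
    have x: "0 \<le> ?x u" "?x u \<le> 1" using q(1) n(2) unfolding c by (auto simp: n_def field_simps)
    have "?x u ^ k \<le> ?x u ^ m" "(1 - ?x u) ^ k \<le> (1 - ?x u) ^ m"
      using x m by (auto intro!: power_decreasing)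
    moreover have "?x u \<le> ((2 * real d + 3) - real u) / (3 * n)"
      "1 - ?x u \<le> ((4 * real d + 2) + real u) / (3 * n)"
    proof -
      have "?x u = (3 * real q + 3) / (3 * n)" "1 - ?x u = (3 * n - 3 * real q - 3) / (3 * n)"
        using n(2) unfolding c by (simp_all add: field_simps)
      then show "?x u \<le> ((2 * real d + 3) - real u) / (3 * n)"
        "1 - ?x u \<le> ((4 * real d + 2) + real u) / (3 * n)"
        using q n(2) by (auto intro!: divide_right_mono simp: n_def)
    qed
    then have "?x u ^ m \<le> (((2 * real d + 3) - real u) / (3 * n)) ^ m"
      "(1 - ?x u) ^ m \<le> (((4 * real d + 2) + real u) / (3 * n)) ^ m"
      using x by (auto intro!: power_mono)
    ultimately show ?thesis by linarith
  qed
  have "real U - (A + B) / (3 * n) ^ m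
      = (\<Sum>u=1..U. 1 - (((2 * real d + 3) - real u) / (3 * n)) ^ m - (((4 * real d + 2) + real u) / (3 * n)) ^ m)"
    unfolding A_def B_def power_divide sum_subtractf sum_divide_distrib[symmetric]
    by (simp add: add_divide_distrib)
  also have "\<dots> \<le> (\<Sum>u=1..U. 1 - ?x u ^ k - (1 - ?x u) ^ k)"
    by (rule sum_mono) (rule cut_bound)
  finally have "2 * (real U - (A + B) / (3 * n) ^ m) \<le> 2 * (\<Sum>u=1..U. 1 - ?x u ^ k - (1 - ?x u) ^ k)"
    by (rule mult_left_mono) simp
  also have "\<dots> \<le> mu_tsp k {..2 * d} (parent_adj (spider_parent d) (2 * d))"
    unfolding n(1)[symmetric]
  proof (rule mu_tsp_ge_cuts)
    show "connected_graph {..2 * d} (parent_adj (spider_parent d) (2 * d))"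
      using is_tree_spider[OF d] by (simp add: is_tree_def)
    show "(\<Sum>u\<in>{1..U}. of_bool ((x \<in> descendants d u) \<noteq> (y \<in> descendants d u))) \<le> (1 :: nat)"
      if "parent_adj (spider_parent d) (2 * d) x y" for x y
      using sum_descendants_crossings_le[OF d that] by (simp only: U_def)
  qed (use k in \<open>auto simp: descendants_def\<close>)
  finally have main: "2 * (real U - (A + B) / (3 * n) ^ m)
      \<le> mu_tsp k {..2 * d} (parent_adj (spider_parent d) (2 * d))" .
  have AB: "real (m + 1) * (A + B) \<le> (4 * real d + 3 + real U) ^ (m + 1) - (4 * real d + 3) ^ (m + 1)
      + (2 * real d + 3) ^ (m + 1) - (2 * real d + 3 - real U) ^ (m + 1)" (is "_ \<le> ?S")
    using sum_power_shift_le[of "4 * real d + 2" m U] sum_power_reflect_le[of U "2 * real d + 3" m] U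
    by (simp add: A_def B_def algebra_simps)
  have "n * profile m (U / n) ((4 * real d + 3 + U) / (3 * n)) ((4 * real d + 3) / (3 * n))
        ((2 * real d + 3) / (3 * n)) ((2 * real d + 3 - U) / (3 * n))
      = n * (2 * (real U / n - 3 / real (m + 1) * (?S / (3 * n) ^ (m + 1))))"
    unfolding profile_def power_divide diff_divide_distrib[symmetric] add_divide_distrib[symmetric] ..
  also have "\<dots> = 2 * (real U - ?S / real (m + 1) / (3 * n) ^ m)"
  proof -
    \<comment> \<open>One of the \<open>m + 1\<close> factors 3 n cancels against the factor 3 in
      \<open>profile\<close> and the outer n.\<close>
    have "n * (2 * (real U / n - 3 / c * (s / (3 * n * p)))) = 2 * (real U - s / c / p)"
      if "0 < c" "0 < p" for s c p :: real
      using n(2) that by (simp add: field_simps)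
    from this[of "real (m + 1)" "(3 * n) ^ m" ?S] show ?thesis using n(2) by simp
  qed
  also have "\<dots> \<le> 2 * (real U - (A + B) / (3 * n) ^ m)"
    using AB n(2) by (intro mult_left_mono diff_left_mono divide_right_mono) (auto simp: field_simps)
  also note main
  finally show ?thesis
    by (simp only: spider_bound_def Let_def n_def U_def)
qed

section \<open>Limits of the two bounds\<close>

lemma binomial_half_ratio_tendsto:
  "(\<lambda>d. real ((d + 1) choose k) / real ((2 * d + 1) choose k)) \<longlonglongrightarrow> (1 / 2) ^ k"
proof -
  have "(\<lambda>d. (real (d + 1) - real i) / (real (2 * d + 1) - real i)) \<longlonglongrightarrow> 1 / 2" for i
    by real_asymp
  then have "(\<lambda>d. \<Prod>i<k. (real (d + 1) - real i) / (real (2 * d + 1) - real i)) \<longlonglongrightarrow> (\<Prod>i<k. 1 / 2)"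
    by (intro tendsto_prod)
  moreover have "\<forall>\<^sub>F d in sequentially. (\<Prod>i<k. (real (d + 1) - real i) / (real (2 * d + 1) - real i))
      = real ((d + 1) choose k) / real ((2 * d + 1) choose k)"
    using eventually_ge_at_top[of k]
    by eventually_elim (rule binomial_ratio_eq_prod[symmetric]; simp)
  ultimately show ?thesis by (simp add: tendsto_cong)
qed

text \<open>There are about 3 d/2 cuts among about 2 d vertices; the parity of d is absorbed by
  enclosing \<open>d div 2\<close> between (d - 1)/2 and d/2.\<close>

lemma num_cuts_ratio_tendsto:
  "(\<lambda>d. real (3 * (d div 2) - 3) / (2 * real d + 1)) \<longlonglongrightarrow> 3 / 4"
proof (rule tendsto_sandwich)
  show "\<forall>\<^sub>F d in sequentially. (3 * (real d - 1) / 2 - 3) / (2 * real d + 1)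
      \<le> real (3 * (d div 2) - 3) / (2 * real d + 1)"
  proof (intro always_eventually allI divide_right_mono)
    fix d :: nat
    have "d \<le> 2 * (d div 2) + 1" by simp
    then have "real d \<le> 2 * real (d div 2) + 1" by linarith
    then have "3 * (real d - 1) / 2 - 3 \<le> 3 * real (d div 2) - 3" by simp
    also have "\<dots> \<le> real (3 * (d div 2) - 3)" by (simp add: of_nat_diff_real)
    finally show "3 * (real d - 1) / 2 - 3 \<le> real (3 * (d div 2) - 3)" .
  qed simp
  show "\<forall>\<^sub>F d in sequentially. real (3 * (d div 2) - 3) / (2 * real d + 1)
      \<le> (3 * real d / 2) / (2 * real d + 1)"
  proof (intro always_eventually allI divide_right_mono)
    fix d :: nat
    have "2 * (d div 2) \<le> d" by simp
    then have "2 * real (d div 2) \<le> real d" by linarith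
    then show "real (3 * (d div 2) - 3) \<le> 3 * real d / 2" by linarith
  qed simp
  show "(\<lambda>d. (3 * (real d - 1) / 2 - 3) / (2 * real d + 1)) \<longlonglongrightarrow> 3 / 4"
    "(\<lambda>d. (3 * real d / 2) / (2 * real d + 1)) \<longlonglongrightarrow> 3 / 4"
    by real_asymp+
qed

lemma spider_bound_tendsto:
  "spider_bound m \<longlonglongrightarrow> profile m (3 / 4) (11 / 12) (2 / 3) (1 / 3) (1 / 12)"
proof -
  define U where "U = (\<lambda>d :: nat. real (3 * (d div 2) - 3))"
  have U: "(\<lambda>d. U d / (2 * real d + 1)) \<longlonglongrightarrow> 3 / 4"
    using num_cuts_ratio_tendsto by (simp add: U_def)
  have B: "(\<lambda>d. (4 * real d + 3) / (3 * (2 * real d + 1))) \<longlonglongrightarrow> 2 / 3" by real_asymp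
  have C: "(\<lambda>d. (2 * real d + 3) / (3 * (2 * real d + 1))) \<longlonglongrightarrow> 1 / 3" by real_asymp
  have U3: "(\<lambda>d. U d / (3 * (2 * real d + 1))) \<longlonglongrightarrow> 1 / 4"
    using tendsto_divide[OF U tendsto_const, of 3] by (simp add: algebra_simps)
  \<comment> \<open>The outer endpoints are 2/3 + 1/4 = 11/12 and 1/3 - 1/4 = 1/12.\<close>
  have A: "(\<lambda>d. (4 * real d + 3 + U d) / (3 * (2 * real d + 1))) \<longlonglongrightarrow> 11 / 12"
    using tendsto_add[OF B U3] by (simp add: add_divide_distrib)
  have D: "(\<lambda>d. (2 * real d + 3 - U d) / (3 * (2 * real d + 1))) \<longlonglongrightarrow> 1 / 12"
    using tendsto_diff[OF C U3] by (simp add: diff_divide_distrib)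
  have profile: "(\<lambda>d. profile m (t d) (a d) (b d) (c d) (e d)) \<longlonglongrightarrow> profile m t' a' b' c' e'"
    if "t \<longlonglongrightarrow> t'" "a \<longlonglongrightarrow> a'" "b \<longlonglongrightarrow> b'" "c \<longlonglongrightarrow> c'" "e \<longlonglongrightarrow> e'"
    for t a b c e t' a' b' c' e'
    unfolding profile_def using that by (intro tendsto_intros)
  show ?thesis
    using profile[OF U A B C D] unfolding spider_bound_def[abs_def] Let_def U_def .
qed

text \<open>The left side is the limit for the cycle. It stays below 1, so exponent 6, whose
  constant exceeds 1, settles every k from 6 on; for k = 4 and k = 5 the exponent is k
  itself.\<close>

lemma profile_gt:
  assumes "4 \<le> k"
  obtains m where "m \<le> k" "1 - 2 * (1 / 2) ^ k < profile m (3 / 4) (11 / 12) (2 / 3) (1 / 3) (1 / 12)"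
proof -
  consider "k = 4" | "k = 5" | "6 \<le> k" using assms by linarith
  then show ?thesis
  proof cases
    case 1
    then show ?thesis using that[of 4] by (simp add: profile_def power_divide)
  next
    case 2
    then show ?thesis using that[of 5] by (simp add: profile_def power_divide)
  next
    case 3
    have "1 < profile 6 (3 / 4) (11 / 12) (2 / 3) (1 / 3) (1 / 12)" by (simp add: profile_def power_divide)
    moreover have "0 < (1 / 2 :: real) ^ k" by simp
    ultimately have "1 - 2 * (1 / 2) ^ k < profile 6 (3 / 4) (11 / 12) (2 / 3) (1 / 3) (1 / 12)" by linarith
    then show ?thesis using that[of 6] 3 by blast
  qed
qed

section \<open>Comparison of cycle and spider\<close>

theorem theorem6:
  fixes k :: nat
  assumes "k \<ge> 4"
  shows "\<exists>D. \<forall>d\<ge>D. \<exists>(V::nat set) E.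
           is_tree V E \<and> diameter V E = d \<and> card V = 2 * d + 1 \<and>
           mu_tsp k {0..<2 * d + 1} (cycle_adj (2 * d + 1)) < mu_tsp k V E"
proof -
  obtain m where m: "m \<le> k" "1 - 2 * (1 / 2) ^ k < profile m (3 / 4) (11 / 12) (2 / 3) (1 / 3) (1 / 12)"
    using profile_gt[OF assms] .
  \<comment> \<open>The upper bound for the cycle divided by n = 2 d + 1, on the same scale as
    \<open>spider_bound\<close>.\<close>
  define h where "h d = 1 + 1 / (2 * real d + 1)
      - 2 * (real ((d + 1) choose k) / real ((2 * d + 1) choose k))" for d
  have "(\<lambda>d. 1 + 1 / (2 * real d + 1)) \<longlonglongrightarrow> 1" by real_asymp
  then have "h \<longlonglongrightarrow> 1 - 2 * (1 / 2) ^ k"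
    unfolding h_def by (intro tendsto_intros binomial_half_ratio_tendsto)
  then have "(\<lambda>d. spider_bound m d - h d)
      \<longlonglongrightarrow> profile m (3 / 4) (11 / 12) (2 / 3) (1 / 3) (1 / 12) - (1 - 2 * (1 / 2) ^ k)"
    by (intro tendsto_diff spider_bound_tendsto)
  \<comment> \<open>The difference of the two bounds has a positive limit, so it is positive for all
    large d.\<close>
  from order_tendstoD(1)[OF this, of 0] m(2)
  have "\<forall>\<^sub>F d in sequentially. 0 < spider_bound m d - h d"
    by (simp only: diff_gt_0_iff_gt)
  then obtain D where D: "\<And>d. D \<le> d \<Longrightarrow> 0 < spider_bound m d - h d"
    by (auto simp: eventually_sequentially)
  show ?thesis
  \<comment> \<open>The value 4 is what the spider lemmas require, and \<open>k \<le> d\<close>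
    ensures that k-sets exist.\<close>
  proof (intro exI[of _ "max D (max 4 k)"] allI impI)
    fix d assume "max D (max 4 k) \<le> d"
    then have d: "D \<le> d" "4 \<le> d" "k \<le> d" by simp_all
    let ?V = "{..2 * d}" and ?E = "parent_adj (spider_parent d) (2 * d)"
    have "mu_tsp k {0..<2 * d + 1} (cycle_adj (2 * d + 1)) \<le> (2 * real d + 1) * h d"
      using mu_tsp_cycle_le[of "2 * d + 1" d k] d assms by (simp add: h_def algebra_simps)
    also have "\<dots> < (2 * real d + 1) * spider_bound m d"
      using D[OF d(1)] by (intro mult_strict_left_mono) auto
    also have "\<dots> \<le> mu_tsp k ?V ?E"
      using mu_tsp_spider_ge[of d k m] d m(1) by simp
    finally have "mu_tsp k {0..<2 * d + 1} (cycle_adj (2 * d + 1)) < mu_tsp k ?V ?E" .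
    then show "\<exists>(V::nat set) E. is_tree V E \<and> diameter V E = d \<and> card V = 2 * d + 1 \<and>
        mu_tsp k {0..<2 * d + 1} (cycle_adj (2 * d + 1)) < mu_tsp k V E"
      using is_tree_spider[OF d(2)] diameter_spider[OF d(2)]
      by (intro exI[of _ ?V] exI[of _ ?E]) simp
  qed
qed

end
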